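(* Let $C\in\mathbb{R}^{m\times n}$, $D\in\mathbb{R}^{m\times m}$, $F\in\mathbb{R}^{r\times n}$, $G\in\mathbb{R}^{r\times m}$, and for each $t\in\mathbb{N}$ let $\Psi_t:\mathbb{R}^r\to\mathcal{P}(\mathbb{R}^m)$ be a set-valued mapping. Assume that the generalized equation $$0\in Cx+Du+\Psi_t(Fx+Gu)$$ admits a unique solution $u$ for each $x\in\mathbb{R}^n$ and $t\in\mathbb{N}$, and denote its solution mapping by $u_t^\ast:\mathbb{R}^n\to\mathbb{R}^m$. If $\Psi_t$ admits the incremental multiplier matrix (IMM) $M\in\mathbb{R}^{(r+m)\times(r+m)}$, then the solution mapping $u_t^\ast$ admits the IMM $$\mathtt{sol}(M):=\begin{bmatrix}F&G\\ -C&-D\end{bmatrix}^\top M\begin{bmatrix}F&G\\ -C&-D\end{bmatrix}.$$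
   Context: $\mathcal{P}(S)$ is the power set of $S$. A set-valued mapping $\Psi:\mathbb{R}^{a}\to\mathcal{P}(\mathbb{R}^{b})$ admits the symmetric matrix $M\in\mathbb{R}^{(a+b)\times(a+b)}$ as an incremental multiplier matrix (IMM) if, for all $z^{(1)},z^{(2)}\in\mathbb{R}^a$ and all $g^{(1)}\in\Psi(z^{(1)})$, $g^{(2)}\in\Psi(z^{(2)})$, $$\begin{bmatrix}z^{(1)}-z^{(2)}\\ g^{(1)}-g^{(2)}\end{bmatrix}^\top M\begin{bmatrix}z^{(1)}-z^{(2)}\\ g^{(1)}-g^{(2)}\end{bmatrix}\ge0.$$ A function is identified with the corresponding single-valued mapping. *)

theory Defs
  imports "HOL-Analysis.Analysis" "HOL-Library.Set_Algebras"
begin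

text \<open>Block vectors and block matrices are indexed by sum types: \<^typ>\<open>'a + 'b\<close> is the index type
  of \<open>\<real>\<^sup>a\<^sup>+\<^sup>b\<close>, with \<^const>\<open>Inl\<close> indexing the first block and \<^const>\<open>Inr\<close> the second.\<close>

definition block_vec :: "'c ^ 'a \<Rightarrow> 'c ^ 'b \<Rightarrow> 'c ^ ('a + 'b)" where
  "block_vec x y = (\<chi> i. case i of Inl k \<Rightarrow> x $ k | Inr k \<Rightarrow> y $ k)"

text \<open>\<open>block_mat P Q R S\<close> has upper blocks \<open>P\<close>, \<open>Q\<close> and lower blocks \<open>R\<close>, \<open>S\<close>.\<close>

definition block_mat ::
  "'c ^ 'a ^ 'd \<Rightarrow> 'c ^ 'b ^ 'd \<Rightarrow> 'c ^ 'a ^ 'e \<Rightarrow> 'c ^ 'b ^ 'e \<Rightarrow> 'c ^ ('a + 'b) ^ ('d + 'e)" where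
  "block_mat P Q R S =
    (\<chi> i. case i of Inl k \<Rightarrow> block_vec (P $ k) (Q $ k) | Inr k \<Rightarrow> block_vec (R $ k) (S $ k))"

definition admits_IMM ::
  "(real ^ 'a \<Rightarrow> (real ^ 'b) set) \<Rightarrow> real ^ ('a + 'b) ^ ('a + 'b) \<Rightarrow> bool" where
  "admits_IMM \<Psi> M \<longleftrightarrow> transpose M = M \<and>
    (\<forall>z1 z2. \<forall>g1 \<in> \<Psi> z1. \<forall>g2 \<in> \<Psi> z2.
      block_vec (z1 - z2) (g1 - g2) \<bullet> (M *v block_vec (z1 - z2) (g1 - g2)) \<ge> 0)"

definition solves_gen_eq ::
  "real ^ 'n ^ 'm \<Rightarrow> real ^ 'm ^ 'm \<Rightarrow> real ^ 'n ^ 'r \<Rightarrow> real ^ 'm ^ 'r \<Rightarrow>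
    (real ^ 'r \<Rightarrow> (real ^ 'm) set) \<Rightarrow> real ^ 'n \<Rightarrow> real ^ 'm \<Rightarrow> bool" where
  "solves_gen_eq C D F G \<Psi> x u \<longleftrightarrow> 0 \<in> (C *v x + D *v u) +o \<Psi> (F *v x + G *v u)"

text \<open>The value is meaningful only if the generalized equation has a unique solution for \<open>x\<close>.\<close>

definition sol_map ::
  "real ^ 'n ^ 'm \<Rightarrow> real ^ 'm ^ 'm \<Rightarrow> real ^ 'n ^ 'r \<Rightarrow> real ^ 'm ^ 'r \<Rightarrow>
    (real ^ 'r \<Rightarrow> (real ^ 'm) set) \<Rightarrow> real ^ 'n \<Rightarrow> real ^ 'm" where
  "sol_map C D F G \<Psi> x = (THE u. solves_gen_eq C D F G \<Psi> x u)"

definition sol_IMM ::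
  "real ^ 'n ^ 'm \<Rightarrow> real ^ 'm ^ 'm \<Rightarrow> real ^ 'n ^ 'r \<Rightarrow> real ^ 'm ^ 'r \<Rightarrow>
    real ^ ('r + 'm) ^ ('r + 'm) \<Rightarrow> real ^ ('n + 'm) ^ ('n + 'm)" where
  "sol_IMM C D F G M =
    transpose (block_mat F G (- C) (- D)) ** M ** block_mat F G (- C) (- D)"

end

theory Submission
  imports Defs
begin

text \<open>
  Let \<open>u\<^sub>i\<close> solve the generalized equation at \<open>x\<^sub>i\<close> and put \<open>z\<^sub>i = F x\<^sub>i + G u\<^sub>i\<close>, \<open>g\<^sub>i = - C x\<^sub>i - D u\<^sub>i\<close>.
  Solving the equation means exactly that \<open>g\<^sub>i\<close> is a value of the set-valued mapping at \<open>z\<^sub>i\<close>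
  (\<open>solves_gen_eq_iff\<close>). The pair \<open>(z\<^sub>i, g\<^sub>i)\<close> is the image of \<open>(x\<^sub>i, u\<^sub>i)\<close> under the block matrix
  with rows \<open>[F G]\<close> and \<open>[-C -D]\<close>, so this matrix also carries the increment of \<open>(x, u)\<close> to the
  increment of \<open>(z, g)\<close>. Hence the quadratic form of the congruence transform of \<open>M\<close> at the former
  is the quadratic form of \<open>M\<close> at the latter (\<open>congruence_quadratic_form\<close>), where it is nonnegative.
\<close>

lemma sum_UNIV_sum_type:
  fixes f :: "'a::finite + 'b::finite \<Rightarrow> 'c::comm_monoid_add"
  shows "sum f UNIV = (\<Sum>k\<in>UNIV. f (Inl k)) + (\<Sum>k\<in>UNIV. f (Inr k))"
  by (simp add: sum.Plus flip: UNIV_Plus_UNIV)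

lemma block_mat_mult_block_vec:
  fixes P :: "'c::semiring_1 ^ 'a::finite ^ 'd" and Q :: "'c ^ 'b::finite ^ 'd"
    and R :: "'c ^ 'a ^ 'e" and S :: "'c ^ 'b ^ 'e"
  shows "block_mat P Q R S *v block_vec x y = block_vec (P *v x + Q *v y) (R *v x + S *v y)"
  by (simp add: vec_eq_iff block_mat_def block_vec_def matrix_vector_mult_def sum_UNIV_sum_type
      split: sum.split)

lemma congruence_quadratic_form:
  fixes A :: "real ^ 'k ^ 'l" and M :: "real ^ 'l ^ 'l"
  shows "v \<bullet> ((transpose A ** M ** A) *v v) = (A *v v) \<bullet> (M *v (A *v v))"
proof -
  have "v \<bullet> (transpose A *v w) = (A *v v) \<bullet> w" for w
    by (metis dot_lmul_matrix vector_transpose_matrix)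
  then show ?thesis
    by (simp flip: matrix_vector_mul_assoc)
qed

lemma transpose_congruence:
  fixes A :: "'c::comm_semiring_1 ^ 'k ^ 'l" and M :: "'c ^ 'l ^ 'l"
  shows "transpose (transpose A ** M ** A) = transpose A ** transpose M ** A"
  by (simp add: matrix_transpose_mul matrix_mul_assoc)

lemma solves_gen_eq_iff:
  "solves_gen_eq C D F G \<Psi> x u \<longleftrightarrow> - (C *v x) - D *v u \<in> \<Psi> (F *v x + G *v u)"
proof -
  have "0 = (C *v x + D *v u) + g \<longleftrightarrow> g = - (C *v x) - D *v u" for g
    using eq_neg_iff_add_eq_0[of g "C *v x + D *v u"] by (auto simp: add.commute)
  then show ?thesis
    by (auto simp: solves_gen_eq_def elt_set_plus_def)
qed

theorem proposition1:
  fixes C :: "real ^ 'n ^ 'm" and D :: "real ^ 'm ^ 'm"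
    and F :: "real ^ 'n ^ 'r" and G :: "real ^ 'm ^ 'r"
    and \<Psi> :: "nat \<Rightarrow> real ^ 'r \<Rightarrow> (real ^ 'm) set"
    and M :: "real ^ ('r + 'm) ^ ('r + 'm)"
    and t :: nat
  assumes unique_sol: "\<And>x t. \<exists>!u. solves_gen_eq C D F G (\<Psi> t) x u"
    and IMM: "admits_IMM (\<Psi> t) M"
  shows "admits_IMM (\<lambda>x. {sol_map C D F G (\<Psi> t) x}) (sol_IMM C D F G M)"
proof -
  define A where "A = block_mat F G (- C) (- D)"
  define u where "u = sol_map C D F G (\<Psi> t)"
  define z where "z x = F *v x + G *v u x" for x
  define g where "g x = - (C *v x) - D *v u x" for x
  have g_in: "g x \<in> \<Psi> t (z x)" for x
    using theI'[OF unique_sol, of t x]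
    by (simp add: solves_gen_eq_iff g_def z_def u_def sol_map_def)
  have neg_mult: "(- B) *v w = - (B *v w)" for B :: "real ^ 'k ^ 'l" and w
    by (simp add: vec_eq_iff matrix_vector_mult_def sum_negf)
  have increment: "A *v block_vec (x1 - x2) (u x1 - u x2) = block_vec (z x1 - z x2) (g x1 - g x2)"
    for x1 x2
    by (simp add: A_def block_mat_mult_block_vec z_def g_def neg_mult
        matrix_vector_mult_diff_distrib algebra_simps)
  have "transpose (sol_IMM C D F G M) = sol_IMM C D F G M"
    using IMM by (simp add: sol_IMM_def transpose_congruence admits_IMM_def)
  moreover have "0 \<le> block_vec (x1 - x2) (u x1 - u x2)
      \<bullet> (sol_IMM C D F G M *v block_vec (x1 - x2) (u x1 - u x2))" for x1 x2
    using IMM g_in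
    by (simp add: sol_IMM_def congruence_quadratic_form increment admits_IMM_def flip: A_def)
  ultimately show ?thesis
    by (simp add: admits_IMM_def u_def)
qed

end
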